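(* Let $p$ be a prime, let $k\ge1$ be an integer, and let $1\le\alpha_1\le\alpha_2\le\dots\le\alpha_k$ be integers. For every integer $\alpha$ with $1\le\alpha\le\alpha_k$, the number of all elements of order $p^\alpha$ in the finite abelian $p$-group $\mathbb{Z}_{p^{\alpha_1}}\times\mathbb{Z}_{p^{\alpha_2}}\times\cdots\times\mathbb{Z}_{p^{\alpha_k}}$ is $$g^k_p(\alpha)\varphi(p^\alpha)=g^k_p(\alpha)\left(p^\alpha-p^{\alpha-1}\right)=p^\alpha h^{k-1}_p(\alpha)-p^{\alpha-1}h^{k-1}_p(\alpha-1).$$
   Context: $\mathbb{Z}_m$ denotes the cyclic group of order $m$ and $\varphi$ is Euler's totient function. $g^k_p(\alpha)$ denotes the number of cyclic subgroups of order $p^\alpha$ of $\mathbb{Z}_{p^{\alpha_1}}\times\cdots\times\mathbb{Z}_{p^{\alpha_k}}$. With the convention $\alpha_0=0$, the function $h^{k-1}_p$ is defined for integers $\alpha\ge0$ by $h^{k-1}_p(\alpha)=p^{(k-1-j)\alpha+\alpha_1+\dots+\alpha_j}$ if $\alpha_j\le\alpha\le\alpha_{j+1}$ for some $0\le j\le k-2$, and $h^{k-1}_p(\alpha)=p^{\alpha_1+\dots+\alpha_{k-1}}$ if $\alpha\ge\alpha_{k-1}$ (so $h^0_p(\alpha)=1$ for all $\alpha\ge0$ when $k=1$). *)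

theory Defs
  imports "HOL-Algebra.Algebra" "HOL-Number_Theory.Totient"
begin

definition abelian_p_group :: "nat \<Rightarrow> nat \<Rightarrow> (nat \<Rightarrow> nat) \<Rightarrow> (nat \<Rightarrow> int) monoid" where
  "abelian_p_group p k a = product_group {1..k} (\<lambda>i. integer_mod_group (p ^ a i))"

definition num_cyclic_subgroups :: "nat \<Rightarrow> nat \<Rightarrow> (nat \<Rightarrow> nat) \<Rightarrow> nat \<Rightarrow> nat" where
  "num_cyclic_subgroups p k a \<alpha> =
     (let G = abelian_p_group p k a in
      card {H. subgroup H G \<and> cyclic_group (G\<lparr>carrier := H\<rparr>) \<and> card H = p ^ \<alpha>})"

text \<open>
  The function \<open>h\<close> with superscript \<open>n\<close> (that is, \<open>n = k - 1\<close>).  The exponents are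
  \<open>a 1, \<dots>, a n\<close>; the update \<open>a(0 := 0)\<close> implements the convention \<open>\<alpha>\<^sub>0 = 0\<close>.
  The cases of the definition overlap when \<open>\<alpha>\<close> is one of the exponents.  Here the last case
  takes precedence, then the least admissible \<open>j\<close>; the lemmas below show that this choice is
  irrelevant when the exponents are nondecreasing.
\<close>

definition h_fun :: "nat \<Rightarrow> nat \<Rightarrow> (nat \<Rightarrow> nat) \<Rightarrow> nat \<Rightarrow> nat" where
  "h_fun p n a \<alpha> =
     (let b = a(0 := 0) in
      if b n \<le> \<alpha> then p ^ (\<Sum>i=1..n. b i)
      else let j = (LEAST j. j < n \<and> b j \<le> \<alpha> \<and> \<alpha> \<le> b (Suc j))
           in p ^ ((n - j) * \<alpha> + (\<Sum>i=1..j. b i)))"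

lemma sum_min_split:
  fixes b :: "nat \<Rightarrow> nat"
  assumes "mono_on {1..n} b" "b 0 = 0" "j < n" "b j \<le> \<alpha>" "\<alpha> \<le> b (Suc j)"
  shows "(\<Sum>i=1..n. min \<alpha> (b i)) = (n - j) * \<alpha> + (\<Sum>i=1..j. b i)"
proof -
  have "{1..n} = {1..j} \<union> {Suc j..n}" using assms(3) by auto
  then have "(\<Sum>i=1..n. min \<alpha> (b i)) =
      (\<Sum>i=1..j. min \<alpha> (b i)) + (\<Sum>i=Suc j..n. min \<alpha> (b i))"
    by (simp add: sum.union_disjoint)
  moreover have "min \<alpha> (b i) = b i" if "i \<in> {1..j}" for i
  proof -
    have "b i \<le> b j" using assms(3) that by (intro mono_onD[OF assms(1)]) auto
    then show ?thesis using assms(4) by simp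
  qed
  moreover have "min \<alpha> (b i) = \<alpha>" if "i \<in> {Suc j..n}" for i
  proof -
    have "b (Suc j) \<le> b i" using assms(3) that by (intro mono_onD[OF assms(1)]) auto
    then show ?thesis using assms(5) by simp
  qed
  ultimately show ?thesis by simp
qed

lemma h_fun_eq_min:
  assumes "mono_on {1..n} a"
  shows "h_fun p n a \<alpha> = p ^ (\<Sum>i=1..n. min \<alpha> (a i))"
proof -
  define b where "b = a(0 := 0)"
  have mb: "mono_on {1..n} b" and b0: "b 0 = 0"
    using assms by (auto simp: b_def mono_on_def)
  have ab: "(\<Sum>i=1..n. min \<alpha> (a i)) = (\<Sum>i=1..n. min \<alpha> (b i))"
    by (rule sum.cong) (auto simp: b_def)
  show ?thesis
  proof (cases "b n \<le> \<alpha>")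
    case True
    have "min \<alpha> (b i) = b i" if "i \<in> {1..n}" for i
    proof -
      have "b i \<le> b n" using that by (intro mono_onD[OF mb]) auto
      then show ?thesis using True by simp
    qed
    then have "(\<Sum>i=1..n. min \<alpha> (b i)) = (\<Sum>i=1..n. b i)" by simp
    then show ?thesis using True unfolding h_fun_def b_def[symmetric] ab Let_def by simp
  next
    case False
    define P where "P j \<longleftrightarrow> j < n \<and> b j \<le> \<alpha> \<and> \<alpha> \<le> b (Suc j)" for j
    define m where "m = (LEAST j. \<alpha> < b j)"
    have m: "\<alpha> < b m" "m \<le> n"
      unfolding m_def using False by (auto intro: LeastI[of _ n] Least_le)
    then have "m \<noteq> 0" using b0 by (cases m) auto
    then obtain l where l: "m = Suc l" using not0_implies_Suc by blast
    then have "\<not> \<alpha> < b l" using not_less_Least[of l "\<lambda>j. \<alpha> < b j"] by (simp add: m_def)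
    then have "P l" using m l by (simp add: P_def)
    then have "P (LEAST j. P j)" by (rule LeastI)
    then have "(\<Sum>i=1..n. min \<alpha> (b i)) =
        (n - (LEAST j. P j)) * \<alpha> + (\<Sum>i=1..(LEAST j. P j). b i)"
      unfolding P_def by (intro sum_min_split[OF mb b0]) auto
    then show ?thesis using False
      unfolding h_fun_def b_def[symmetric] ab Let_def P_def by simp
  qed
qed

lemma h_fun_between:
  assumes "mono_on {1..n} a" "j < n" "(a(0 := 0)) j \<le> \<alpha>" "\<alpha> \<le> a (Suc j)"
  shows "h_fun p n a \<alpha> = p ^ ((n - j) * \<alpha> + (\<Sum>i=1..j. a i))"
proof -
  define b where "b = a(0 := 0)"
  have "(\<Sum>i=1..n. min \<alpha> (b i)) = (n - j) * \<alpha> + (\<Sum>i=1..j. b i)"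
    using assms by (intro sum_min_split) (auto simp: b_def mono_on_def)
  moreover have "(\<Sum>i=1..n. min \<alpha> (b i)) = (\<Sum>i=1..n. min \<alpha> (a i))"
    "(\<Sum>i=1..j. b i) = (\<Sum>i=1..j. a i)"
    by (auto simp: b_def intro!: sum.cong)
  ultimately show ?thesis by (simp add: h_fun_eq_min[OF assms(1)])
qed

lemma h_fun_above:
  assumes "(a(0 := 0)) n \<le> \<alpha>"
  shows "h_fun p n a \<alpha> = p ^ (\<Sum>i=1..n. a i)"
proof -
  have "(\<Sum>i=1..n. (a(0 := 0)) i) = (\<Sum>i=1..n. a i)"
    by (rule sum.cong) auto
  with assms show ?thesis unfolding h_fun_def Let_def by simp
qed

end

theory Submission
  imports Defs
begin

text \<open>
  In a finite group, sending an element to the subgroup it generates maps the elements of order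
  \<open>n\<close> onto the cyclic subgroups of order \<open>n\<close>, and each fibre is the set of generators of a cyclic
  group of order \<open>n\<close>, of which there are \<open>totient n\<close>
  (\<open>card_ord_eq_cyclic_subgroups_times_totient\<close>).

  For a prime \<open>p\<close>, an element has order \<open>p ^ \<alpha>\<close> iff it is killed by \<open>p ^ \<alpha>\<close> but not by
  \<open>p ^ (\<alpha> - 1)\<close>, so these elements are also counted by a difference of two torsion counts
  (\<open>card_ord_eq_prime_power\<close>). Torsion of a product is computed factor by factor, and the cyclic group
  of order \<open>p ^ m\<close> has \<open>p ^ min b m\<close> elements killed by \<open>p ^ b\<close>. Hence the product has
  \<open>p ^ (\<Sum>i=1..k. min b (a i))\<close> such elements. For \<open>b \<le> a k\<close> the last factor contributes \<open>p ^ b\<close> and the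
  other \<open>k - 1\<close> factors contribute \<open>h_fun p (k - 1) a b\<close>
  (\<open>card_torsion_abelian_p_group_h_fun\<close>); taking \<open>b = \<alpha>\<close> and \<open>b = \<alpha> - 1\<close> gives the formula.
\<close>

section \<open>Elements and cyclic subgroups of a given order\<close>

context group
begin

lemma cyclic_group_carrier_update_iff:
  assumes "subgroup H G"
  shows "cyclic_group (G\<lparr>carrier := H\<rparr>) \<longleftrightarrow> (\<exists>x\<in>H. H = range (\<lambda>n::int. x [^] n))"
proof -
  interpret S: group "G\<lparr>carrier := H\<rparr>"
    by (rule subgroup.subgroup_is_group[OF assms is_group])
  have "x [^]\<^bsub>G\<lparr>carrier := H\<rparr>\<^esub> n = x [^] n" if "x \<in> H" for x and n :: int
    using int_pow_consistent[OF assms that] by simp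
  then show ?thesis by (auto simp: S.cyclic_group)
qed

lemma cyclic_group_carrier_update_iff_generate:
  assumes "subgroup H G"
  shows "cyclic_group (G\<lparr>carrier := H\<rparr>) \<longleftrightarrow> (\<exists>x\<in>H. H = generate G {x})"
proof -
  have "range (\<lambda>n::int. x [^] n) = generate G {x}" if "x \<in> H" for x
    using generate_pow[of x] subgroup.mem_carrier[OF assms that] by auto
  then show ?thesis by (auto simp: cyclic_group_carrier_update_iff[OF assms])
qed

text \<open>
  With \<open>n\<close> the order of \<open>g\<close>, the power \<open>g [^] k\<close> has order \<open>n div gcd n k\<close> for positive \<open>k\<close>, so it
  generates the same subgroup as \<open>g\<close> exactly when \<open>k\<close> is coprime to \<open>n\<close>.
\<close>
lemma card_generators_cyclic_subgroup:
  assumes "finite (carrier G)" "g \<in> carrier G"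
  shows "card {x \<in> carrier G. generate G {x} = generate G {g}} = totient (ord g)"
proof -
  have pos: "ord g > 0" using ord_ge_1[OF assms] by simp
  have fin: "finite (generate G {g})"
    using assms generate_incl[of "{g}"] finite_subset by blast
  have "{x \<in> carrier G. generate G {x} = generate G {g}} = (\<lambda>k. g [^] k) ` totatives (ord g)"
  proof (intro Set.set_eqI iffI)
    fix x assume "x \<in> {x \<in> carrier G. generate G {x} = generate G {g}}"
    then have x: "x \<in> carrier G" "generate G {x} = generate G {g}" by auto
    then have ord_x: "ord x = ord g" using assms by (simp add: generate_pow_card)
    have "x \<in> generate G {g}" using x generate.incl[of x "{x}" G] by simp
    then obtain j :: nat where j: "x = g [^] j" "j \<le> ord g - 1"
      using generate_pow_on_finite_carrier[OF assms] ord_elems[OF assms] by auto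
    \<comment> \<open>Totatives are positive, so the exponent 0 is replaced by the order of \<open>g\<close>.\<close>
    define k where "k = (if j = 0 then ord g else j)"
    have xk: "x = g [^] k" using j assms by (simp add: k_def)
    have k: "0 < k" "k \<le> ord g" using pos j by (auto simp: k_def)
    have "ord g div gcd (ord g) k = ord g"
      using ord_x ord_pow_gen[OF assms(2), of k] k xk by simp
    then have "gcd (ord g) k = 1"
      using pos by (metis div_eq_dividend_iff)
    then have "k \<in> totatives (ord g)"
      using k by (simp add: totatives_def coprime_iff_gcd_eq_1 gcd.commute)
    then show "x \<in> (\<lambda>k. g [^] k) ` totatives (ord g)" using xk by blast
  next
    fix x assume "x \<in> (\<lambda>k. g [^] k) ` totatives (ord g)"
    then obtain k where k: "x = g [^] k" "0 < k" "coprime k (ord g)"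
      by (auto simp: totatives_def)
    have xc: "x \<in> carrier G" using k assms by simp
    have "ord x = ord g"
      using k ord_pow_gen[OF assms(2), of k] by (simp add: coprime_iff_gcd_eq_1 gcd.commute)
    \<comment> \<open>Inclusion of finite sets of equal size forces equality.\<close>
    then have "card (generate G {x}) = card (generate G {g})"
      using generate_pow_card xc assms by metis
    moreover have "x \<in> generate G {g}"
      using k generate_pow_on_finite_carrier[OF assms] by auto
    then have "generate G {x} \<subseteq> generate G {g}"
      using generate_subgroup_incl[of "{x}" "generate G {g}"] generate_is_subgroup[of "{g}"] assms
      by simp
    ultimately have "generate G {x} = generate G {g}"
      using card_subset_eq[OF fin] by blast
    then show "x \<in> {x \<in> carrier G. generate G {x} = generate G {g}}" using xc by simp
  qed
  moreover have "inj_on (\<lambda>k. g [^] k) (totatives (ord g))"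
    by (rule inj_on_subset[OF ord_inj'[OF assms(2)]]) (auto simp: totatives_def)
  ultimately show ?thesis by (simp add: card_image totient_def)
qed

lemma card_ord_eq_cyclic_subgroups_times_totient:
  assumes "finite (carrier G)"
  shows "card {x \<in> carrier G. ord x = n} =
    card {H. subgroup H G \<and> cyclic_group (G\<lparr>carrier := H\<rparr>) \<and> card H = n} * totient n"
proof -
  define A where "A = {x \<in> carrier G. ord x = n}"
  define C where "C = {H. subgroup H G \<and> cyclic_group (G\<lparr>carrier := H\<rparr>) \<and> card H = n}"
  have C: "C = (\<lambda>x. generate G {x}) ` A"
  proof (intro Set.set_eqI iffI)
    fix H assume "H \<in> C"
    then have H: "subgroup H G" "card H = n" and "\<exists>x\<in>H. H = generate G {x}"
      by (auto simp: C_def cyclic_group_carrier_update_iff_generate)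
    then obtain x where x: "x \<in> H" "H = generate G {x}" by blast
    have "x \<in> carrier G" using subgroup.mem_carrier[OF H(1) x(1)] .
    then have "x \<in> A" using generate_pow_card H x by (auto simp: A_def)
    then show "H \<in> (\<lambda>x. generate G {x}) ` A" using x by blast
  next
    fix H assume "H \<in> (\<lambda>x. generate G {x}) ` A"
    then obtain x where x: "x \<in> carrier G" "ord x = n" "H = generate G {x}"
      by (auto simp: A_def)
    then have "subgroup H G" using generate_is_subgroup[of "{x}"] by simp
    moreover have "x \<in> H" using x generate.incl[of x "{x}" G] by simp
    ultimately show "H \<in> C"
      using x generate_pow_card[of x] by (auto simp: C_def cyclic_group_carrier_update_iff_generate)
  qed
  have finA: "finite A" using assms by (simp add: A_def)
  have fibre: "card {x \<in> A. generate G {x} = H} = totient n" if "H \<in> C" for H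
  proof -
    obtain g where g: "g \<in> carrier G" "ord g = n" "H = generate G {g}"
      using \<open>H \<in> C\<close> by (auto simp: C A_def)
    then have "{x \<in> A. generate G {x} = H} = {x \<in> carrier G. generate G {x} = generate G {g}}"
      by (auto simp: A_def generate_pow_card)
    then show ?thesis using card_generators_cyclic_subgroup[OF assms g(1)] g by simp
  qed
  have "card A = card (\<Union>H\<in>C. {x \<in> A. generate G {x} = H})"
    by (rule arg_cong[where f = card]) (auto simp: C)
  also have "\<dots> = (\<Sum>H\<in>C. card {x \<in> A. generate G {x} = H})"
    using finA by (intro card_UN_disjoint) (auto simp: C)
  also have "\<dots> = card C * totient n" using fibre by simp
  finally show ?thesis by (simp add: A_def C_def)
qed

lemma card_ord_eq_prime_power:
  fixes p b :: nat
  assumes "finite (carrier G)" "Factorial_Ring.prime p"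
  shows "int (card {x \<in> carrier G. ord x = p ^ Suc b}) =
    int (card {x \<in> carrier G. x [^] (p ^ Suc b) = \<one>}) - int (card {x \<in> carrier G. x [^] (p ^ b) = \<one>})"
proof -
  let ?K = "\<lambda>c. {x \<in> carrier G. x [^] (p ^ c) = \<one>}"
  have ord_iff: "ord x = p ^ Suc b \<longleftrightarrow> ord x dvd p ^ Suc b \<and> \<not> ord x dvd p ^ b" for x
  proof
    assume "ord x = p ^ Suc b"
    then show "ord x dvd p ^ Suc b \<and> \<not> ord x dvd p ^ b"
      using prime_gt_1_nat[OF assms(2)] by (auto dest: power_dvd_imp_le)
  next
    assume R: "ord x dvd p ^ Suc b \<and> \<not> ord x dvd p ^ b"
    then obtain i where i: "i \<le> Suc b" "ord x = p ^ i"
      using divides_primepow_nat[OF assms(2)] by blast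
    then have "\<not> i \<le> b" using R le_imp_power_dvd[of i b p] by auto
    then show "ord x = p ^ Suc b" using i by (metis le_antisym not_less_eq_eq)
  qed
  have K: "?K c = {x \<in> carrier G. ord x dvd p ^ c}" for c
    using pow_eq_id by blast
  have "{x \<in> carrier G. ord x = p ^ Suc b} = ?K (Suc b) - ?K b"
    unfolding K using ord_iff by blast
  moreover have sub: "?K b \<subseteq> ?K (Suc b)"
    unfolding K using le_imp_power_dvd[of b "Suc b" p] dvd_trans by auto
  moreover have fin: "finite (?K c)" for c using assms(1) by simp
  ultimately show ?thesis
    using card_mono[OF fin[of "Suc b"] sub] card_Diff_subset[OF fin[of b] sub] by (simp add: of_nat_diff)
qed

end

section \<open>Torsion in products of cyclic groups\<close>

lemma pow_product_group:
  fixes n :: nat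
  shows "x [^]\<^bsub>product_group I G\<^esub> n = (\<lambda>i\<in>I. x i [^]\<^bsub>G i\<^esub> n)"
  by (induction n) (auto simp: nat_pow_def intro!: restrict_ext)

lemma torsion_product_group:
  fixes n :: nat
  shows "{x \<in> carrier (product_group I G). x [^]\<^bsub>product_group I G\<^esub> n = \<one>\<^bsub>product_group I G\<^esub>} =
    (\<Pi>\<^sub>E i\<in>I. {y \<in> carrier (G i). y [^]\<^bsub>G i\<^esub> n = \<one>\<^bsub>G i\<^esub>})"
proof -
  have "x [^]\<^bsub>product_group I G\<^esub> n = \<one>\<^bsub>product_group I G\<^esub> \<longleftrightarrow> (\<forall>i\<in>I. x i [^]\<^bsub>G i\<^esub> n = \<one>\<^bsub>G i\<^esub>)"
    for x
    unfolding pow_product_group by (auto simp: restrict_def fun_eq_iff)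
  then have "{x \<in> carrier (product_group I G). x [^]\<^bsub>product_group I G\<^esub> n = \<one>\<^bsub>product_group I G\<^esub>} =
    {x \<in> carrier (product_group I G). \<forall>i\<in>I. x i [^]\<^bsub>G i\<^esub> n = \<one>\<^bsub>G i\<^esub>}"
    by blast
  then show ?thesis by (auto simp: PiE_iff extensional_def)
qed

text \<open>Modulo \<open>d * e\<close>, the elements killed by \<open>d\<close> are the \<open>d\<close> multiples of \<open>e\<close>.\<close>
lemma card_torsion_integer_mod_group:
  assumes "d > 0" "e > 0"
  shows "card {y \<in> carrier (integer_mod_group (d * e)). y [^]\<^bsub>integer_mod_group (d * e)\<^esub> d = 0} = d"
proof -
  have "{y \<in> carrier (integer_mod_group (d * e)). y [^]\<^bsub>integer_mod_group (d * e)\<^esub> d = 0}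
    = (\<lambda>t. int e * t) ` {0..<int d}"
  proof (intro Set.set_eqI iffI)
    fix y assume "y \<in> {y \<in> carrier (integer_mod_group (d * e)). y [^]\<^bsub>integer_mod_group (d * e)\<^esub> d = 0}"
    then have y: "0 \<le> y" "y < int d * int e" "int d * int e dvd int d * y"
      using assms by (auto simp: carrier_integer_mod_group mod_eq_0_iff_dvd)
    then obtain t where t: "y = int e * t" using assms by auto
    then have "0 \<le> t" "t < int d" using y assms by (auto simp: zero_le_mult_iff mult.commute)
    then show "y \<in> (\<lambda>t. int e * t) ` {0..<int d}" using t by auto
  qed (use assms in \<open>auto simp: carrier_integer_mod_group mult.commute\<close>)
  moreover have "inj_on (\<lambda>t. int e * t) {0..<int d}" using assms by (auto simp: inj_on_def)
  ultimately show ?thesis by (simp add: card_image)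
qed

lemma card_torsion_integer_mod_prime_power:
  fixes p :: nat
  assumes "p > 0"
  shows "card {y \<in> carrier (integer_mod_group (p ^ m)).
    y [^]\<^bsub>integer_mod_group (p ^ m)\<^esub> (p ^ b) = \<one>\<^bsub>integer_mod_group (p ^ m)\<^esub>} = p ^ min b m"
proof (cases "b \<le> m")
  case True
  then have "p ^ m = p ^ b * p ^ (m - b)" by (simp flip: power_add)
  then show ?thesis
    using card_torsion_integer_mod_group[of "p ^ b" "p ^ (m - b)"] assms True by (simp del: pow_integer_mod_group)
next
  case False
  \<comment> \<open>The exponent is then a multiple of the group order, which kills every element.\<close>
  then have "int (p ^ m) dvd int (p ^ b)" by (simp add: le_imp_power_dvd)
  then have "{y \<in> carrier (integer_mod_group (p ^ m)).
    y [^]\<^bsub>integer_mod_group (p ^ m)\<^esub> (p ^ b) = \<one>\<^bsub>integer_mod_group (p ^ m)\<^esub>} = {0..<int (p ^ m)}"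
    using assms by (auto simp: carrier_integer_mod_group mod_eq_0_iff_dvd simp del: of_nat_power)
  then show ?thesis using False by (simp del: of_nat_power)
qed

lemma group_abelian_p_group: "group (abelian_p_group p k a)"
  by (simp add: abelian_p_group_def)

lemma finite_carrier_abelian_p_group:
  assumes "p > 0"
  shows "finite (carrier (abelian_p_group p k a))"
  using assms by (auto simp: abelian_p_group_def carrier_integer_mod_group intro!: finite_PiE)

lemma card_torsion_abelian_p_group:
  assumes "p > 0"
  shows "card {x \<in> carrier (abelian_p_group p k a).
      x [^]\<^bsub>abelian_p_group p k a\<^esub> (p ^ b) = \<one>\<^bsub>abelian_p_group p k a\<^esub>} =
    p ^ (\<Sum>i=1..k. min b (a i))"
  unfolding abelian_p_group_def torsion_product_group
  using card_torsion_integer_mod_prime_power[OF assms]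
  by (simp add: card_PiE power_sum del: pow_integer_mod_group one_integer_mod_group)

lemma card_torsion_abelian_p_group_h_fun:
  assumes "p > 0" "1 \<le> k" "mono_on {1..k} a" "b \<le> a k"
  shows "card {x \<in> carrier (abelian_p_group p k a).
      x [^]\<^bsub>abelian_p_group p k a\<^esub> (p ^ b) = \<one>\<^bsub>abelian_p_group p k a\<^esub>} =
    p ^ b * h_fun p (k - 1) a b"
proof -
  obtain m where m: "k = Suc m" using assms(2) by (cases k) auto
  have "mono_on {1..m} a" using assms(3) by (rule mono_on_subset) (simp add: m)
  then show ?thesis
    using assms by (simp add: card_torsion_abelian_p_group h_fun_eq_min m power_add)
qed

theorem corollary4p4:
  fixes p k \<alpha> :: nat and a :: "nat \<Rightarrow> nat"
  assumes "Factorial_Ring.prime p" and "1 \<le> k"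
    and "1 \<le> a 1" and "mono_on {1..k} a"
    and "1 \<le> \<alpha>" and "\<alpha> \<le> a k"
  shows "card {x \<in> carrier (abelian_p_group p k a). group.ord (abelian_p_group p k a) x = p ^ \<alpha>}
           = num_cyclic_subgroups p k a \<alpha> * totient (p ^ \<alpha>)
       \<and> int (num_cyclic_subgroups p k a \<alpha> * totient (p ^ \<alpha>))
           = int (num_cyclic_subgroups p k a \<alpha>) * (int p ^ \<alpha> - int p ^ (\<alpha> - 1))
       \<and> int (num_cyclic_subgroups p k a \<alpha>) * (int p ^ \<alpha> - int p ^ (\<alpha> - 1))
           = int p ^ \<alpha> * int (h_fun p (k - 1) a \<alpha>)
             - int p ^ (\<alpha> - 1) * int (h_fun p (k - 1) a (\<alpha> - 1))"
proof -
  obtain b where b: "\<alpha> = Suc b" using assms(5) by (cases \<alpha>) auto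
  have pos: "p > 0" using assms(1) by (rule prime_gt_0_nat)
  let ?G = "abelian_p_group p k a"
  let ?A = "{x \<in> carrier ?G. group.ord ?G x = p ^ \<alpha>}"
  interpret group ?G by (rule group_abelian_p_group)
  note fin = finite_carrier_abelian_p_group[OF pos, of k a]
  have count: "card ?A = num_cyclic_subgroups p k a \<alpha> * totient (p ^ \<alpha>)"
    using card_ord_eq_cyclic_subgroups_times_totient[OF fin, of "p ^ \<alpha>"]
    by (simp only: num_cyclic_subgroups_def Let_def)
  have "int (totient (p ^ \<alpha>)) = int p ^ \<alpha> - int p ^ (\<alpha> - 1)"
    using totient_prime_power_Suc[OF assms(1), of b] pos
    by (simp add: b of_nat_diff algebra_simps)
  then have tot: "int (num_cyclic_subgroups p k a \<alpha> * totient (p ^ \<alpha>))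
      = int (num_cyclic_subgroups p k a \<alpha>) * (int p ^ \<alpha> - int p ^ (\<alpha> - 1))"
    by simp
  have "int (card ?A) = int p ^ \<alpha> * int (h_fun p (k - 1) a \<alpha>)
      - int p ^ (\<alpha> - 1) * int (h_fun p (k - 1) a (\<alpha> - 1))"
    using card_ord_eq_prime_power[OF fin assms(1), of b]
      card_torsion_abelian_p_group_h_fun[OF pos assms(2,4), of "Suc b"]
      card_torsion_abelian_p_group_h_fun[OF pos assms(2,4), of b] assms(6)
    unfolding b by simp
  then show ?thesis using count tot by simp
qed

end
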